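(* For an arithmetic function $f:\mathbb{N}\to\mathbb{C}$, $n\in\mathbb{N}$ and $t\in\mathbb{Z}$ let $$P_{f,t}(n):=\sum_{k\in\mathrm{Reg}_n}f(\gcd(k,n))\exp(2\pi i kt/n).$$ Then for every arithmetic function $f$, every $n\in\mathbb{N}$ and every $t\in\mathbb{Z}$, $$P_{f,t}(n)=\sum_{d\,\|\,n}f(d)\,c_{n/d}(t).$$ Moreover, if $f$ is integer valued and multiplicative (in particular, if $f(n)=n$ for all $n\in\mathbb{N}$), then for every $t\in\mathbb{Z}$ the function $n\mapsto P_{f,t}(n)$ is also integer valued and multiplicative.
   Context: $\mathbb{N}=\{1,2,\ldots\}$. An integer $k$ is called regular (mod $n$) if there exists $x\in\mathbb{Z}$ with $k^2x\equiv k\pmod n$, and $\mathrm{Reg}_n=\{k\in\mathbb{N}:1\le k\le n,\ k\text{ is regular (mod }n)\}$. $d\,\|\,n$ means that $d$ is a unitary divisor of $n$, i.e. $d\ge1$, $d\mid n$ and $\gcd(d,n/d)=1$. $c_n(t)=\sum_{1\le k\le n,\ \gcd(k,n)=1}\exp(2\pi ikt/n)$ is the Ramanujan sum. An arithmetic function $f$ is multiplicative if $f(1)=1$ and $f(mn)=f(m)f(n)$ whenever $\gcd(m,n)=1$. *)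

theory Defs
  imports Complex_Main "HOL-Number_Theory.Cong"
begin

text \<open>
  Arithmetic functions, defined on the positive integers, are represented by functions of type
  \<^typ>\<open>nat \<Rightarrow> complex\<close> whose value at \<open>0\<close> is irrelevant: all
  properties below are restricted to positive arguments.
\<close>

definition integer_valued :: "(nat \<Rightarrow> complex) \<Rightarrow> bool" where
  "integer_valued f \<longleftrightarrow> (\<forall>n\<ge>1. f n \<in> \<int>)"

definition multiplicative_arith :: "(nat \<Rightarrow> complex) \<Rightarrow> bool" where
  "multiplicative_arith f \<longleftrightarrow>
     f 1 = 1 \<and> (\<forall>m\<ge>1. \<forall>n\<ge>1. coprime m n \<longrightarrow> f (m * n) = f m * f n)"

definition regular_mod :: "nat \<Rightarrow> int \<Rightarrow> bool" where
  "regular_mod n k \<longleftrightarrow> (\<exists>x::int. [k\<^sup>2 * x = k] (mod int n))"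

definition Reg :: "nat \<Rightarrow> nat set" where
  "Reg n = {k. 1 \<le> k \<and> k \<le> n \<and> regular_mod n (int k)}"

definition unitary_divisor :: "nat \<Rightarrow> nat \<Rightarrow> bool" where
  "unitary_divisor d n \<longleftrightarrow> 1 \<le> d \<and> d dvd n \<and> coprime d (n div d)"

definition ramanujan_sum :: "nat \<Rightarrow> int \<Rightarrow> complex" where
  "ramanujan_sum n t =
     (\<Sum>k | 1 \<le> k \<and> k \<le> n \<and> coprime k n.
        exp (2 * of_real pi * \<i> * of_nat k * of_int t / of_nat n))"

definition reg_sum :: "(nat \<Rightarrow> complex) \<Rightarrow> int \<Rightarrow> nat \<Rightarrow> complex" where
  "reg_sum f t n =
     (\<Sum>k\<in>Reg n. f (gcd k n) * exp (2 * of_real pi * \<i> * of_nat k * of_int t / of_nat n))"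

end

theory Submission
  imports Defs "HOL-Analysis.Complex_Transcendental"
begin

text \<open>
  An integer \<open>k\<close> is regular modulo \<open>n\<close> exactly if \<open>gcd(k, n)\<close> is a unitary divisor
  of \<open>n\<close>, so grouping the terms of \<open>P\<^sub>f\<^sub>,\<^sub>t(n)\<close> by the value of the gcd gives the
  convolution formula. The same grouping with \<open>f = 1\<close> over all \<open>k \<le> n\<close> shows that
  \<open>\<Sum>d | n. c\<^sub>d(t)\<close> equals \<open>n\<close> if \<open>n | t\<close> and \<open>0\<close> otherwise. This function of \<open>n\<close> is
  integer valued and multiplicative, and strong induction transfers both properties to
  \<open>c\<^sub>n(t)\<close>, avoiding Moebius inversion and the Chinese remainder theorem.
\<close>

section \<open>Regular integers and unitary divisors\<close>

text \<open>With \<open>d = gcd k n\<close>, \<open>k = d * j\<close> and \<open>n = d * m\<close>,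
  cancelling \<open>d\<close> and then \<open>j\<close>, which is coprime to \<open>m\<close>, turns
  the congruence into \<open>k * x = 1\<close> modulo \<open>m\<close>. This is solvable iff
  \<open>k\<close>, equivalently \<open>d\<close>, is coprime to \<open>m\<close>.\<close>

lemma regular_mod_iff_unitary_divisor:
  fixes k n :: nat
  assumes "n \<ge> 1"
  shows "regular_mod n (int k) \<longleftrightarrow> unitary_divisor (gcd k n) n"
proof -
  define d where "d = gcd k n"
  define m where "m = n div d"
  define j where "j = k div d"
  have d: "d \<ge> 1" using assms by (simp add: d_def Suc_leI)
  have n: "n = d * m" by (simp add: d_def m_def)
  have k: "k = d * j" by (simp add: d_def j_def)
  have jm: "coprime j m"
    using assms unfolding j_def m_def d_def by (intro div_gcd_coprime) auto
  have dvd_iff: "[(int k)\<^sup>2 * x = int k] (mod int n) \<longleftrightarrow> [int k * x = 1] (mod int m)" for x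
  proof -
    have "(int k)\<^sup>2 * x - int k = int d * (int j * (int k * x - 1))"
      by (simp add: k power2_eq_square algebra_simps)
    then have "[(int k)\<^sup>2 * x = int k] (mod int n) \<longleftrightarrow> int m dvd int j * (int k * x - 1)"
      using d by (simp add: cong_iff_dvd_diff n)
    also have "\<dots> \<longleftrightarrow> int m dvd int k * x - 1"
      using jm by (simp add: coprime_commute coprime_dvd_mult_right_iff)
    finally show ?thesis by (simp add: cong_iff_dvd_diff)
  qed
  have "regular_mod n (int k) \<longleftrightarrow> coprime (int k) (int m)"
    unfolding regular_mod_def dvd_iff by (rule coprime_iff_invertible_int[symmetric])
  also have "\<dots> \<longleftrightarrow> coprime d m"
    using jm by (simp add: k)
  also have "\<dots> \<longleftrightarrow> unitary_divisor d n"
    using d by (simp add: unitary_divisor_def m_def) (simp add: d_def)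
  finally show ?thesis by (simp add: d_def)
qed

section \<open>Grouping exponential sums by the gcd\<close>

text \<open>The \<open>k\<close> with gcd \<open>d\<close> are the \<open>d * j\<close> with
  \<open>j\<close> coprime to \<open>n div d\<close>, and the factor \<open>d\<close> cancels in the
  exponent.\<close>

lemma ramanujan_sum_div:
  assumes "n \<ge> 1" "d dvd n"
  shows "ramanujan_sum (n div d) t =
    (\<Sum>k | k \<in> {1..n} \<and> gcd k n = d. exp (2 * of_real pi * \<i> * of_nat k * of_int t / of_nat n))"
proof -
  obtain m where n: "n = d * m" using assms(2) by blast
  have pos: "d > 0" "m > 0" using assms(1) n by (auto intro: Nat.gr0I)
  show ?thesis unfolding ramanujan_sum_def
  proof (rule sum.reindex_bij_witness[where i = "\<lambda>k. k div d" and j = "\<lambda>j. d * j"], goal_cases)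
    case (2 j)
    then show ?case using pos n by (auto simp: gcd_mult_distrib_nat[symmetric])
  next
    case (3 k)
    then show ?case by auto
  next
    case (4 k)
    then have "d dvd k" by auto
    then obtain j where j: "k = d * j" by blast
    then show ?case using 4 pos n by (auto simp: gcd_mult_distrib_nat[symmetric] coprime_iff_gcd_eq_1)
  qed (use pos n in \<open>auto simp: field_simps\<close>)
qed

text \<open>The weight \<open>h\<close> is arbitrary because two choices are needed:
  \<open>f\<close> cut off to the unitary divisors, and the constant 1.\<close>

lemma sum_gcd_exp:
  fixes h :: "nat \<Rightarrow> complex"
  assumes "n \<ge> 1"
  shows "(\<Sum>k\<in>{1..n}. h (gcd k n) * exp (2 * of_real pi * \<i> * of_nat k * of_int t / of_nat n)) =
    (\<Sum>d | d dvd n. h d * ramanujan_sum (n div d) t)"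
    (is "sum (\<lambda>k. h (gcd k n) * ?e k) _ = _")
proof -
  have "(\<Sum>k\<in>{1..n}. h (gcd k n) * ?e k) =
      (\<Sum>d | d dvd n. \<Sum>k | k \<in> {1..n} \<and> gcd k n = d. h (gcd k n) * ?e k)"
    using assms by (intro sum.group[symmetric]) auto
  also have "\<dots> = (\<Sum>d | d dvd n. h d * ramanujan_sum (n div d) t)"
    using assms by (intro sum.cong refl) (auto simp: ramanujan_sum_div sum_distrib_left intro!: sum.cong)
  finally show ?thesis .
qed

theorem reg_sum_eq:
  assumes "n \<ge> 1"
  shows "reg_sum f t n = (\<Sum>d | unitary_divisor d n. f d * ramanujan_sum (n div d) t)"
proof -
  \<comment> \<open>Extending \<open>f\<close> by zero replaces the sum over \<open>Reg n\<close> by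
    one over all of \<open>{1..n}\<close>.\<close>
  define h where "h d = (if unitary_divisor d n then f d else 0)" for d
  have Reg: "Reg n = {k \<in> {1..n}. unitary_divisor (gcd k n) n}"
    using assms by (auto simp: Reg_def regular_mod_iff_unitary_divisor)
  have "reg_sum f t n =
      (\<Sum>k\<in>{1..n}. h (gcd k n) * exp (2 * of_real pi * \<i> * of_nat k * of_int t / of_nat n))"
    unfolding reg_sum_def Reg h_def by (subst sum.inter_filter) (auto intro!: sum.cong)
  also have "\<dots> = (\<Sum>d | d dvd n. h d * ramanujan_sum (n div d) t)"
    by (rule sum_gcd_exp[OF assms])
  also have "\<dots> = (\<Sum>d | unitary_divisor d n. f d * ramanujan_sum (n div d) t)"
    using assms by (intro sum.mono_neutral_cong_right) (auto simp: h_def unitary_divisor_def)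
  finally show ?thesis .
qed

section \<open>Divisors of a product of coprime numbers\<close>

lemma bij_betw_divisors_coprime:
  fixes m n :: nat
  assumes "coprime m n" "m \<ge> 1" "n \<ge> 1"
  shows "bij_betw (\<lambda>(a, b). a * b) ({a. a dvd m} \<times> {b. b dvd n}) {d. d dvd m * n}"
proof (rule bij_betw_imageI)
  show "inj_on (\<lambda>(a, b). a * b) ({a. a dvd m} \<times> {b. b dvd n})"
  proof (rule inj_onI, clarsimp)
    fix a b a' b'
    assume dvd: "a dvd m" "b dvd n" "a' dvd m" "b' dvd n" and eq: "a * b = a' * b'"
    \<comment> \<open>Since \<open>a\<close> divides \<open>a' * b'\<close> and is coprime to
      \<open>b'\<close>, it divides \<open>a'\<close>; the converse is symmetric.\<close>
    have "coprime a b'" "coprime a' b"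
      using assms(1) dvd by (auto intro: coprime_divisors)
    then have "a = a'"
      by (metis coprime_dvd_mult_left_iff dvd_antisym dvd_triv_left eq)
    moreover have "a > 0" using dvd assms by (auto intro: Nat.gr0I)
    ultimately show "a = a' \<and> b = b'" using eq by simp
  qed
  show "(\<lambda>(a, b). a * b) ` ({a. a dvd m} \<times> {b. b dvd n}) = {d. d dvd m * n}"
  proof (intro equalityI subsetI)
    fix d assume "d \<in> {d. d dvd m * n}"
    then obtain a b where "d = a * b" "a dvd m" "b dvd n"
      using division_decomp[of d m n] by auto
    then show "d \<in> (\<lambda>(a, b). a * b) ` ({a. a dvd m} \<times> {b. b dvd n})" by force
  qed (auto intro: mult_dvd_mono)
qed

lemma sum_divisors_coprime:
  fixes m n :: nat and g :: "nat \<Rightarrow> 'a :: comm_monoid_add"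
  assumes "coprime m n" "m \<ge> 1" "n \<ge> 1"
  shows "(\<Sum>d | d dvd m * n. g d) = (\<Sum>(a, b)\<in>{a. a dvd m} \<times> {b. b dvd n}. g (a * b))"
  by (subst sum.reindex_bij_betw[OF bij_betw_divisors_coprime[OF assms], symmetric])
    (simp add: case_prod_unfold)

section \<open>Ramanujan sums\<close>

lemma sum_exp_multiples:
  assumes "n \<ge> 1"
  shows "(\<Sum>k\<in>{1..n}. exp (2 * of_real pi * \<i> * of_nat k * of_int t / of_nat n)) =
    (if int n dvd t then of_nat n else 0)"
proof -
  define w where "w = exp (2 * of_real pi * \<i> * of_int t / of_nat n)"
  have w_pow: "exp (2 * of_real pi * \<i> * of_nat k * of_int t / of_nat n) = w ^ k" for k
    by (simp add: w_def exp_of_nat_mult[symmetric] mult_ac)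
  have "w ^ n = exp (2 * of_real pi * \<i> * of_int t)"
    using assms by (simp add: w_pow[symmetric] mult.assoc)
  also have "\<dots> = 1"
    by (auto simp: exp_eq_1)
  finally have wn: "w ^ n = 1" .
  have w1: "w = 1 \<longleftrightarrow> int n dvd t"
  proof -
    have "w = 1 \<longleftrightarrow> (\<exists>q::int. 2 * pi * of_int t / of_nat n = of_int (2 * q) * pi)"
      by (simp add: w_def exp_eq_1)
    also have "\<dots> \<longleftrightarrow> (\<exists>q::int. real_of_int t = real_of_int (int n * q))"
      using assms by (intro ex_cong1) (simp add: field_simps)
    finally show ?thesis by (simp only: of_int_eq_iff dvd_def)
  qed
  \<comment> \<open>Starting at exponent 1 instead of 0 costs a factor \<open>w\<close>. It is
    harmless: either \<open>w = 1\<close>, or the geometric sum vanishes because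
    \<open>w ^ n = 1\<close>.\<close>
  have "(\<Sum>k\<in>{1..n}. w ^ k) = w * (\<Sum>k<n. w ^ k)"
    by (simp add: sum_distrib_left sum.atLeast1_atMost_eq)
  also have "\<dots> = (if int n dvd t then of_nat n else 0)"
    using w1 wn by (auto simp: geometric_sum)
  finally show ?thesis by (simp add: w_pow)
qed

text \<open>The involution sending \<open>d\<close> to \<open>n div d\<close> brings the sum into
  the form of \<open>sum_gcd_exp\<close> with weight 1.\<close>

lemma sum_ramanujan_sum_divisors:
  assumes "n \<ge> 1"
  shows "(\<Sum>d | d dvd n. ramanujan_sum d t) = (if int n dvd t then of_nat n else 0)"
proof -
  have "(\<Sum>d | d dvd n. ramanujan_sum d t) = (\<Sum>d | d dvd n. ramanujan_sum (n div d) t)"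
    by (rule sum.reindex_bij_witness[where i = "\<lambda>d. n div d" and j = "\<lambda>d. n div d"])
      (use assms in \<open>auto simp: div_dvd_iff_mult\<close>)
  also have "\<dots> = (if int n dvd t then of_nat n else 0)"
    using sum_gcd_exp[OF assms, of "\<lambda>_. 1" t] sum_exp_multiples[OF assms, of t] by simp
  finally show ?thesis .
qed

text \<open>The term at \<open>n\<close> is the integral divisor sum minus the terms at proper
  divisors, which are integers by induction.\<close>

lemma ramanujan_sum_Ints: "n \<ge> 1 \<Longrightarrow> ramanujan_sum n t \<in> \<int>"
proof (induction n rule: less_induct)
  case (less n)
  have "(\<Sum>d | d dvd n. ramanujan_sum d t) =
      ramanujan_sum n t + (\<Sum>d\<in>{d. d dvd n} - {n}. ramanujan_sum d t)"
    using less.prems by (intro sum.remove) auto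
  then have "ramanujan_sum n t =
      (if int n dvd t then of_nat n else 0) - (\<Sum>d\<in>{d. d dvd n} - {n}. ramanujan_sum d t)"
    using sum_ramanujan_sum_divisors[OF less.prems, of t] by (simp add: algebra_simps)
  moreover have "(\<Sum>d\<in>{d. d dvd n} - {n}. ramanujan_sum d t) \<in> \<int>"
  proof (rule Ints_sum)
    fix d assume d: "d \<in> {d. d dvd n} - {n}"
    then have "d \<le> n" "d \<noteq> 0" using less.prems by (auto intro: dvd_imp_le)
    with d show "ramanujan_sum d t \<in> \<int>" by (intro less.IH) auto
  qed
  ultimately show ?case by auto
qed

text \<open>Summed over all pairs of divisors of \<open>m\<close> and \<open>n\<close>, both sides
  agree. By induction on the product they agree at every pair except possibly \<open>(m, n)\<close>,
  hence also there.\<close>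

lemma ramanujan_sum_mult:
  "m \<ge> 1 \<Longrightarrow> n \<ge> 1 \<Longrightarrow> coprime m n \<Longrightarrow>
    ramanujan_sum (m * n) t = ramanujan_sum m t * ramanujan_sum n t"
proof (induction "m * n" arbitrary: m n rule: less_induct)
  case less
  let ?c = "\<lambda>n. ramanujan_sum n t"
  let ?D = "{a. a dvd m} \<times> {b. b dvd n}"
  have fin: "finite ?D" and mem: "(m, n) \<in> ?D"
    using less.prems by auto
  have "(\<Sum>(a, b)\<in>?D. ?c (a * b)) = (\<Sum>d | d dvd m * n. ?c d)"
    using less.prems by (intro sum_divisors_coprime[symmetric]) auto
  \<comment> \<open>For coprime \<open>m\<close> and \<open>n\<close>, the product divides
    \<open>t\<close> iff both factors do, so the closed form of the divisor sum is
    multiplicative.\<close>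
  also have "\<dots> = (\<Sum>a | a dvd m. ?c a) * (\<Sum>b | b dvd n. ?c b)"
    using less.prems by (auto simp: sum_ramanujan_sum_divisors divides_mult)
  also have "\<dots> = (\<Sum>(a, b)\<in>?D. ?c a * ?c b)"
    by (simp add: sum_product sum.cartesian_product)
  finally have eq: "(\<Sum>(a, b)\<in>?D. ?c (a * b)) = (\<Sum>(a, b)\<in>?D. ?c a * ?c b)" .
  have "(\<Sum>(a, b)\<in>?D - {(m, n)}. ?c (a * b)) = (\<Sum>(a, b)\<in>?D - {(m, n)}. ?c a * ?c b)"
  proof (intro sum.cong refl)
    fix p assume p: "p \<in> ?D - {(m, n)}"
    obtain a b where ab_eq: "p = (a, b)" by fastforce
    with p have ab: "a dvd m" "b dvd n" "a = m \<longrightarrow> b \<noteq> n" by auto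
    have le: "a \<le> m" "b \<le> n" using ab less.prems by (auto intro: dvd_imp_le)
    have pos: "a \<ge> 1" "b \<ge> 1" using ab less.prems by (auto simp: Suc_le_eq intro: Nat.gr0I)
    have "a * b \<noteq> m * n"
    proof
      assume eq: "a * b = m * n"
      \<comment> \<open>Enlarging one factor of \<open>a * b\<close> at a time and cancelling gives
        \<open>m \<le> a\<close> and \<open>n \<le> b\<close>.\<close>
      have "m * n \<le> a * n" "m * n \<le> m * b"
        using le by (simp_all add: eq[symmetric])
      then have "a = m" "b = n" using le less.prems by auto
      then show False using ab by simp
    qed
    moreover have "a * b \<le> m * n" using le by (rule mult_le_mono)
    ultimately have "a * b < m * n" by simp
    moreover have "coprime a b" using less.prems(3) ab by (auto intro: coprime_divisors)
    ultimately have "?c (a * b) = ?c a * ?c b" using pos by (intro less.hyps)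
    then show "(case p of (a, b) \<Rightarrow> ?c (a * b)) = (case p of (a, b) \<Rightarrow> ?c a * ?c b)"
      by (simp add: ab_eq)
  qed
  then show ?case
    using eq by (simp add: sum.remove[OF fin mem])
qed

section \<open>Unitary convolution\<close>

text \<open>Coprimality of \<open>m\<close> and \<open>n\<close> settles the cross conditions
  between \<open>a\<close> and \<open>n div b\<close> and between \<open>b\<close> and
  \<open>m div a\<close>; what remains is one condition for each factor.\<close>

lemma unitary_divisor_mult_iff:
  assumes "coprime m n" "a dvd m" "b dvd n" "m \<ge> 1" "n \<ge> 1"
  shows "unitary_divisor (a * b) (m * n) \<longleftrightarrow> unitary_divisor a m \<and> unitary_divisor b n"
proof -
  obtain a' where m: "m = a * a'" using assms(2) by blast
  obtain b' where n: "n = b * b'" using assms(3) by blast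
  have pos: "a > 0" "a' > 0" "b > 0" "b' > 0" using assms m n by (auto intro: Nat.gr0I)
  have "m * n = (a * b) * (a' * b')" by (simp add: m n)
  then have "m * n div (a * b) = a' * b'" using pos by simp
  moreover have "coprime a b'" "coprime b a'"
    using assms(1) by (auto simp: m n coprime_commute)
  ultimately show ?thesis
    using pos assms by (auto simp: unitary_divisor_def m n)
qed

lemma multiplicative_unitary_convolution:
  fixes f c :: "nat \<Rightarrow> complex"
  assumes f: "multiplicative_arith f" and c: "multiplicative_arith c"
  shows "multiplicative_arith (\<lambda>n. \<Sum>d | unitary_divisor d n. f d * c (n div d))"
  unfolding multiplicative_arith_def
proof (intro conjI allI impI)
  have "{d. unitary_divisor d 1} = {1}" by (auto simp: unitary_divisor_def)
  then show "(\<Sum>d | unitary_divisor d 1. f d * c (1 div d)) = 1"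
    using f c by (simp add: multiplicative_arith_def)
next
  fix m n :: nat
  assume mn: "m \<ge> 1" "n \<ge> 1" "coprime m n"
  \<comment> \<open>Extension by zero lets the sum run over all divisors, so that the bijection
    between divisors of \<open>m * n\<close> and pairs applies; \<open>F\<close> then factors along
    it.\<close>
  define F where "F n d = (if unitary_divisor d n then f d * c (n div d) else 0)" for n d
  have sum_F: "(\<Sum>d | unitary_divisor d n. f d * c (n div d)) = (\<Sum>d | d dvd n. F n d)"
    if "n \<ge> 1" for n
    using that by (intro sum.mono_neutral_cong_left) (auto simp: F_def unitary_divisor_def)
  have F_mult: "F (m * n) (a * b) = F m a * F n b" if "a dvd m" "b dvd n" for a b
  proof -
    obtain a' where m: "m = a * a'" using \<open>a dvd m\<close> by blast
    obtain b' where n: "n = b * b'" using \<open>b dvd n\<close> by blast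
    have pos: "a > 0" "a' > 0" "b > 0" "b' > 0" using mn m n by (auto intro: Nat.gr0I)
    have "m * n = (a * b) * (a' * b')" by (simp add: m n)
    then have div: "m * n div (a * b) = a' * b'" "m div a = a'" "n div b = b'"
      using pos m n by simp_all
    have "coprime a b" "coprime a' b'" using mn(3) by (auto simp: m n)
    then have "f (a * b) = f a * f b" "c (a' * b') = c a' * c b'"
      using f c pos by (auto simp: multiplicative_arith_def Suc_le_eq)
    then show ?thesis
      using unitary_divisor_mult_iff[OF mn(3) that mn(1,2)] by (simp add: F_def div)
  qed
  have "(\<Sum>d | d dvd m * n. F (m * n) d) = (\<Sum>(a, b)\<in>{a. a dvd m} \<times> {b. b dvd n}. F m a * F n b)"
    unfolding sum_divisors_coprime[OF mn(3,1,2)] by (intro sum.cong) (auto simp: F_mult)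
  also have "\<dots> = (\<Sum>a | a dvd m. F m a) * (\<Sum>b | b dvd n. F n b)"
    by (simp add: sum_product sum.cartesian_product)
  finally show "(\<Sum>d | unitary_divisor d (m * n). f d * c (m * n div d)) =
      (\<Sum>d | unitary_divisor d m. f d * c (m div d)) * (\<Sum>d | unitary_divisor d n. f d * c (n div d))"
    using mn by (simp add: sum_F)
qed

lemma multiplicative_ramanujan_sum: "multiplicative_arith (\<lambda>n. ramanujan_sum n t)"
proof -
  \<comment> \<open>At 1 the divisor sum consists of this single term.\<close>
  have "ramanujan_sum 1 t = 1"
    using sum_ramanujan_sum_divisors[of 1 t] by simp
  then show ?thesis by (simp add: multiplicative_arith_def ramanujan_sum_mult)
qed

theorem integer_valued_reg_sum:
  assumes "integer_valued f"
  shows "integer_valued (reg_sum f t)"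
  unfolding integer_valued_def
proof (intro allI impI)
  fix n :: nat assume n: "n \<ge> 1"
  show "reg_sum f t n \<in> \<int>"
    unfolding reg_sum_eq[OF n]
  proof (intro Ints_sum Ints_mult)
    fix d assume "d \<in> {d. unitary_divisor d n}"
    then have d: "d \<ge> 1" "n div d \<ge> 1"
      using n by (auto simp: unitary_divisor_def Suc_le_eq div_greater_zero_iff intro: dvd_imp_le)
    then show "f d \<in> \<int>" using assms by (simp add: integer_valued_def)
    show "ramanujan_sum (n div d) t \<in> \<int>" using d(2) by (rule ramanujan_sum_Ints)
  qed
qed

text \<open>The convolution formula holds for positive \<open>n\<close> only, which suffices since
  \<open>multiplicative_arith\<close> inspects only positive arguments.\<close>

theorem multiplicative_reg_sum:
  assumes "multiplicative_arith f"
  shows "multiplicative_arith (reg_sum f t)"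
  using multiplicative_unitary_convolution[OF assms multiplicative_ramanujan_sum[of t]]
  by (simp add: multiplicative_arith_def reg_sum_eq)

theorem proposition5p2p1:
  shows "(\<forall>(f :: nat \<Rightarrow> complex) (n :: nat) (t :: int). n \<ge> 1 \<longrightarrow>
            reg_sum f t n = (\<Sum>d | unitary_divisor d n. f d * ramanujan_sum (n div d) t)) \<and>
         (\<forall>f :: nat \<Rightarrow> complex. integer_valued f \<and> multiplicative_arith f \<longrightarrow>
            (\<forall>t :: int. integer_valued (reg_sum f t) \<and> multiplicative_arith (reg_sum f t))) \<and>
         (\<forall>t :: int. integer_valued (reg_sum (\<lambda>n. of_nat n) t) \<and>
                     multiplicative_arith (reg_sum (\<lambda>n. of_nat n) t))"
proof -
  have "integer_valued (\<lambda>n. of_nat n)" "multiplicative_arith (\<lambda>n. of_nat n)"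
    by (simp_all add: integer_valued_def multiplicative_arith_def)
  then show ?thesis
    using reg_sum_eq integer_valued_reg_sum multiplicative_reg_sum by blast
qed

end
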